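(* There exist a Boolean algebra $B$ of size $\aleph_1$ and a $\{\vee,0\}$-homomorphism $\mu\colon B\to D$ such that the following holds: (a) $\mu(1_B)=\infty$; (b) there are no maps $\mu_0,\mu_1\colon B\to D$ that satisfy the following properties: (i) $\mu(x)=\mu_0(x)\vee\mu_1(x)$ for all $x\in B$; (ii) $\mu_0$ and $\mu_1$ are order-preserving; (iii) $\mu_\ell(1_B)\le a_\ell$ for all $\ell<2$ (that is, for $\ell\in\{0,1\}$).
   Context: A $\{\vee,0\}$-semilattice is a join-semilattice with a least element $0$; a $\{\vee,0\}$-homomorphism is a map preserving binary joins and $0$. $D$ denotes the $\{\vee,0\}$-semilattice with underlying set $D=\omega\cup\{a_0,a_1,\infty\}$ (where $a_0,a_1,\infty$ are three distinct elements not in $\omega=\{0,1,2,\dots\}$), in which $\omega$ with its usual order is a $\{\vee,0\}$-subsemilattice (so $m\vee n=\max(m,n)$ for $m,n\in\omega$, and $0$ is the least element), $n<a_\ell<\infty$ for all $n\in\omega$ and $\ell\in\{0,1\}$, $a_0$ and $a_1$ are incomparable, and $a_0\vee a_1=\infty$. *)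

theory Defs
  imports "HOL-Algebra.Lattice"
begin

unbundle cardinal_syntax

datatype D = Fin nat | A0 | A1 | Infty

instantiation D :: bounded_semilattice_sup_bot
begin

fun less_eq_D :: "D \<Rightarrow> D \<Rightarrow> bool" where
  "Fin m \<le> Fin n \<longleftrightarrow> m \<le> n"
| "Fin m \<le> A0 \<longleftrightarrow> True"
| "Fin m \<le> A1 \<longleftrightarrow> True"
| "x \<le> Infty \<longleftrightarrow> True"
| "A0 \<le> y \<longleftrightarrow> y = A0"
| "A1 \<le> y \<longleftrightarrow> y = A1"
| "Infty \<le> y \<longleftrightarrow> False"

definition less_D :: "D \<Rightarrow> D \<Rightarrow> bool" where
  "x < y \<longleftrightarrow> x \<le> y \<and> \<not> y \<le> (x :: D)"

fun sup_D :: "D \<Rightarrow> D \<Rightarrow> D" where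
  "sup (Fin m) (Fin n) = Fin (max m n)"
| "sup (Fin m) y = y"
| "sup x (Fin n) = x"
| "sup A0 A0 = A0"
| "sup A1 A1 = A1"
| "sup x y = Infty"

definition bot_D :: D where
  "bot = Fin 0"

instance
proof
  fix x y z :: D
  show "(x < y) = (x \<le> y \<and> \<not> y \<le> x)" by (rule less_D_def)
  show "x \<le> x" by (cases x) auto
  show "x \<le> z" if "x \<le> y" "y \<le> z" using that by (cases x; cases y; cases z) auto
  show "x = y" if "x \<le> y" "y \<le> x" using that by (cases x; cases y) auto
  show "x \<le> sup x y" by (cases x; cases y) auto
  show "y \<le> sup x y" by (cases x; cases y) auto
  show "sup y z \<le> x" if "y \<le> x" "z \<le> x" using that by (cases x; cases y; cases z) auto
  show "bot \<le> x" by (cases x) (auto simp: bot_D_def)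
qed

end

text \<open>
  Boolean algebras are bounded distributive complemented lattices on a carrier set, so that their
  cardinality can be prescribed. For algebras of size aleph one (the cardinal successor of
  \<^const>\<open>natLeq\<close>), any element type at least that large, such as \<^typ>\<open>nat set set\<close>, is no
  restriction up to isomorphism. Joins, meets and bounds are the order-theoretic ones of the
  underlying partial order.
\<close>

locale boolean_lattice = bounded_lattice L for L (structure) +
  assumes distrib:
    "\<lbrakk>x \<in> carrier L; y \<in> carrier L; z \<in> carrier L\<rbrakk>
      \<Longrightarrow> x \<sqinter> (y \<squnion> z) = (x \<sqinter> y) \<squnion> (x \<sqinter> z)"
    and complemented:
    "x \<in> carrier L \<Longrightarrow> \<exists>y\<in>carrier L. x \<sqinter> y = \<bottom> \<and> x \<squnion> y = \<top>"

text \<open>Only the values of the map on the carrier matter.\<close>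

definition join_zero_hom :: "('a, 'm) gorder_scheme \<Rightarrow> ('a \<Rightarrow> 'b::bounded_semilattice_sup_bot) \<Rightarrow> bool"
  where "join_zero_hom L f \<longleftrightarrow>
    f \<bottom>\<^bsub>L\<^esub> = bot \<and> (\<forall>x\<in>carrier L. \<forall>y\<in>carrier L. f (x \<squnion>\<^bsub>L\<^esub> y) = sup (f x) (f y))"

end

theory Submission
  imports Defs "HOL-Analysis.Sigma_Algebra" "HOL-Library.Countable_Set_Type"
begin

text \<open>
  Take a set \<open>X\<close> of size \<open>\<aleph>\<^sub>1\<close>, laid out as a square grid by coordinates \<open>r, c\<close> with
  \<open>X \<cong> X \<times> X\<close>, and let \<open>B\<close> be a field of subsets of \<open>X\<close> of size \<open>\<aleph>\<^sub>1\<close> containing all rows and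
  columns. Fix \<open>N : X \<times> X \<rightarrow> \<omega>\<close> and let \<open>\<mu>(S)\<close> be the maximum of \<open>N\<close> on \<open>S\<close> if \<open>S\<close> is finite, and
  otherwise \<open>a\<^sub>0\<close>, \<open>a\<^sub>1\<close> or \<open>\<infinity>\<close> according as \<open>S\<close> meets finitely many rows, finitely many columns,
  or neither. For a splitting \<open>\<mu>\<^sub>0, \<mu>\<^sub>1\<close>, the value of \<open>\<mu>\<^sub>1\<close> on row \<open>a\<close> is some \<open>f(a) < \<omega>\<close>, and that of
  \<open>\<mu>\<^sub>0\<close> on column \<open>b\<close> is some \<open>g(b) < \<omega>\<close>; evaluating at the point where they meet gives
  \<open>N(a, b) \<le> max(f(a), g(b))\<close>. To rule this out for all \<open>f, g\<close>, well-order \<open>X\<close> in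
  type \<open>\<omega>\<^sub>1\<close> and let \<open>N(-, b)\<close> be injective on the predecessors of \<open>b\<close>. Then \<open>f\<close> and \<open>g\<close> are bounded
  on uncountable sets, and some element of the second set lies above infinitely many elements
  of the first.
\<close>

section \<open>Fields of sets of prescribed cardinality\<close>

text \<open>Closing \<open>G\<close> in countably many stages under the single operation
  \<open>nor\<close>, the complement of a union, yields all Boolean operations. As \<open>G\<close>
  is infinite, neither a stage nor the union of all stages exceeds \<open>|G|\<close>.\<close>

lemma algebra_generated_card:
  assumes "infinite G" "G \<subseteq> Pow \<Omega>"
  obtains M where "algebra \<Omega> M" "G \<subseteq> M" "|M| =o |G|"
proof -
  define nor where "nor = (\<lambda>(a, b). \<Omega> - (a \<union> b))"
  define C where "C = rec_nat G (\<lambda>_ S. S \<union> nor ` (S \<times> S))"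
  define M where "M = (\<Union>n. C n)"
  have C_0: "C 0 = G" and C_Suc: "C (Suc n) = C n \<union> nor ` (C n \<times> C n)" for n
    by (simp_all add: C_def)
  have mono: "C m \<subseteq> C n" if "m \<le> n" for m n
    using that by (rule lift_Suc_mono_le[rotated]) (simp add: C_Suc)
  have sub: "C n \<subseteq> Pow \<Omega>" for n
    using assms(2) by (induction n) (auto simp: C_0 C_Suc nor_def)
  have card: "|C n| \<le>o |G|" for n
  proof (induction n)
    case 0
    show ?case by (simp add: C_0 ordLeq_refl card_of_Card_order)
  next
    case (Suc n)
    have "|C n \<times> C n| \<le>o |G|"
      using assms(1) Suc
      by (intro card_of_Times_ordLeq_infinite_Field card_of_Card_order) (simp_all add: Field_card_of)
    then have "|nor ` (C n \<times> C n)| \<le>o |G|"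
      using card_of_image ordLeq_transitive by blast
    with Suc assms(1) show ?case
      unfolding C_Suc
      by (intro card_of_Un_ordLeq_infinite_Field card_of_Card_order) (simp_all add: Field_card_of)
  qed
  have nor: "\<Omega> - (a \<union> b) \<in> M" if ab: "a \<in> M" "b \<in> M" for a b
  proof -
    obtain m n where "a \<in> C m" "b \<in> C n"
      using ab unfolding M_def by blast
    then have "a \<in> C (max m n)" "b \<in> C (max m n)"
      using mono[of m "max m n"] mono[of n "max m n"] by auto
    then have "nor (a, b) \<in> C (Suc (max m n))"
      unfolding C_Suc by blast
    then show ?thesis
      unfolding M_def nor_def by auto
  qed
  have G: "G \<subseteq> M"
    unfolding M_def using C_0 by blast
  have subM: "M \<subseteq> Pow \<Omega>"
    unfolding M_def using sub by blast
  have compl: "\<Omega> - a \<in> M" if "a \<in> M" for a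
    using nor[OF that that] by simp
  have Un: "a \<union> b \<in> M" if "a \<in> M" "b \<in> M" for a b
  proof -
    have "\<Omega> - (\<Omega> - (a \<union> b)) = a \<union> b"
      using subM that by blast
    then show ?thesis
      using compl[OF nor[OF that]] by simp
  qed
  obtain a where a: "a \<in> M"
    using assms(1) G by fastforce
  then have "\<Omega> - (a \<union> (\<Omega> - a)) \<in> M"
    by (intro nor compl)
  moreover have "\<Omega> - (a \<union> (\<Omega> - a)) = {}"
    by blast
  ultimately have empty: "{} \<in> M"
    by (simp only:)
  have "|M| \<le>o |G|"
    unfolding M_def using assms(1) card
    by (intro card_of_UNION_ordLeq_infinite) (auto simp: infinite_iff_card_of_nat[symmetric])
  moreover have "|G| \<le>o |M|"
    using G by (rule card_of_mono1)
  ultimately have "|M| =o |G|"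
    by (simp add: ordIso_iff_ordLeq)
  moreover have "algebra \<Omega> M"
    unfolding algebra_iff_Un using subM empty compl Un by blast
  ultimately show ?thesis
    using that G by blast
qed

section \<open>Uncountable sets and an unbounded matrix\<close>

lemma uncountable_iff_cardSuc_natLeq: "uncountable A \<longleftrightarrow> cardSuc natLeq \<le>o |A|"
proof -
  have "uncountable A \<longleftrightarrow> natLeq <o |A|"
    unfolding countable_card_le_natLeq
    using not_ordLeq_iff_ordLess[OF natLeq_Well_order card_of_Well_order] .
  then show ?thesis
    by (simp only: cardSuc_ordLess_ordLeq[OF natLeq_Card_order card_of_Card_order])
qed

lemma uncountable_if_card_aleph1:
  assumes "|A| =o cardSuc natLeq"
  shows "uncountable A"
  unfolding uncountable_iff_cardSuc_natLeq
  using assms by (rule ordIso_imp_ordLeq[OF ordIso_symmetric])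

lemma uncountable_bounded_part:
  fixes f :: "'a \<Rightarrow> nat"
  assumes "uncountable X"
  obtains n where "uncountable {x \<in> X. f x \<le> n}"
proof -
  have "X = (\<Union>n. {x \<in> X. f x \<le> n})"
    by auto
  with assms have "\<not> (\<forall>n. countable {x \<in> X. f x \<le> n})"
    using countable_UN[of UNIV "\<lambda>n. {x \<in> X. f x \<le> n}"] by auto
  with that show ?thesis
    by blast
qed

lemma ex_aleph1_matrix_not_max_bounded:
  assumes "|X| =o cardSuc natLeq"
  shows "\<exists>N :: 'a \<Rightarrow> 'a \<Rightarrow> nat. \<forall>f g. \<exists>a\<in>X. \<exists>b\<in>X. max (f a) (g b) < N a b"
proof -
  \<comment> \<open>The cardinal \<open>|X|\<close> is itself a well-order of \<open>X\<close> of
    least possible length, so each proper initial segment has fewer than aleph one elements.\<close>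
  define below where "below = underS |X|"
  have Fld: "Field |X| = X"
    by (rule Field_card_of)
  have countable_below: "countable (below b)" if "b \<in> X" for b
  proof -
    have "|below b| <o |X|"
      unfolding below_def using that Fld by (intro card_of_underS card_of_Card_order) simp
    then have "|below b| <o cardSuc natLeq"
      using assms ordLess_ordIso_trans by blast
    then show ?thesis
      using uncountable_iff_cardSuc_natLeq not_ordLess_ordLeq by blast
  qed
  have total: "a \<in> insert b (below b) \<or> b \<in> below a" if "a \<in> X" "b \<in> X" for a b
  proof -
    have "total_on X |X|"
      using card_of_Well_order[of X] unfolding well_order_on_def linear_order_on_def Fld by blast
    with that show ?thesis
      unfolding below_def underS_def total_on_def by auto
  qed
  define N where "N a b = to_nat_on (below b) a" for a b
  have "\<forall>f g. \<exists>a\<in>X. \<exists>b\<in>X. max (f a) (g b) < N a b"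
  proof (intro allI, rule ccontr)
    fix f g :: "'a \<Rightarrow> nat"
    assume "\<not> (\<exists>a\<in>X. \<exists>b\<in>X. max (f a) (g b) < N a b)"
    then have fg: "N a b \<le> max (f a) (g b)" if "a \<in> X" "b \<in> X" for a b
      using that by (auto simp: not_less le_max_iff_disj)
    have "uncountable X"
      using assms by (rule uncountable_if_card_aleph1)
    obtain m where m: "uncountable {a \<in> X. f a \<le> m}"
      using \<open>uncountable X\<close> by (rule uncountable_bounded_part)
    obtain n where n: "uncountable {b \<in> X. g b \<le> n}"
      using \<open>uncountable X\<close> by (rule uncountable_bounded_part)
    have "infinite {a \<in> X. f a \<le> m}"
      using m countable_finite by blast
    \<comment> \<open>\<open>A\<close> is taken countable so that its downward closure
      \<open>U\<close> stays countable and cannot cover the uncountable set of all \<open>b\<close>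
      with \<open>g b \<le> n\<close>.\<close>
    then obtain A where A: "A \<subseteq> {a \<in> X. f a \<le> m}" "countable A" "infinite A"
      using infinite_countable_subset' by blast
    define U where "U = (\<Union>a\<in>A. insert a (below a))"
    have "countable U"
      unfolding U_def using A(1) countable_below by (intro countable_UN A(2)) auto
    with n have "\<not> {b \<in> X. g b \<le> n} \<subseteq> U"
      using countable_subset by metis
    then obtain b where b: "b \<in> X" "g b \<le> n" "b \<notin> U"
      by auto
    \<comment> \<open>As \<open>b\<close> is neither in \<open>A\<close> nor below an element of
      \<open>A\<close>, totality puts all of \<open>A\<close> below \<open>b\<close>. There
      \<open>N\<close> is injective in its first argument, yet bounded by
      \<open>max m n\<close>.\<close>
    then have "A \<subseteq> below b"
      using A(1) total unfolding U_def by blast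
    then have "inj_on (\<lambda>a. N a b) A"
      unfolding N_def using inj_on_to_nat_on[OF countable_below[OF b(1)]] inj_on_subset by blast
    moreover have "(\<lambda>a. N a b) ` A \<subseteq> {..max m n}"
    proof
      fix k
      assume "k \<in> (\<lambda>a. N a b) ` A"
      then obtain a where a: "a \<in> A" "k = N a b"
        by blast
      then have "a \<in> X" "f a \<le> m"
        using A(1) by auto
      then have "k \<le> max (f a) (g b)"
        using a(2) b(1) fg by simp
      also have "\<dots> \<le> max m n"
        using \<open>f a \<le> m\<close> b(2) by (rule max.mono)
      finally show "k \<in> {..max m n}"
        by simp
    qed
    ultimately have "finite A"
      by (meson finite_atMost finite_imageD finite_subset)
    with A(3) show False
      by contradiction
  qed
  then show ?thesis
    by (rule exI[of _ N])
qed

section \<open>The join homomorphism on a grid\<close>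

text \<open>The inserted \<open>0\<close> sends the empty set to the bottom of \<open>D\<close>. If
  \<open>r\<close> and \<open>c\<close> are jointly injective on \<open>S\<close>, then an infinite
  \<open>S\<close> cannot have both images finite, so the conditions for \<open>A0\<close> and
  \<open>A1\<close> exclude each other.\<close>

definition grid_map :: "('a \<Rightarrow> 'b) \<Rightarrow> ('a \<Rightarrow> 'b) \<Rightarrow> ('a \<Rightarrow> nat) \<Rightarrow> 'a set \<Rightarrow> D" where
  "grid_map r c N S =
    (if finite S then Fin (Max (insert 0 (N ` S)))
     else if finite (r ` S) then A0
     else if finite (c ` S) then A1
     else Infty)"

lemma finite_if_finite_coordinates:
  assumes "inj_on (\<lambda>x. (r x, c x)) S" "finite (r ` S)" "finite (c ` S)"
  shows "finite S"
proof -
  have "(\<lambda>x. (r x, c x)) ` S \<subseteq> r ` S \<times> c ` S"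
    by auto
  then have "finite ((\<lambda>x. (r x, c x)) ` S)"
    using assms(2,3) finite_subset finite_SigmaI by blast
  then show ?thesis
    using assms(1) by (rule finite_imageD)
qed

text \<open>Subsets of \<open>X\<close> meeting finitely many rows form an ideal, as do those
  meeting finitely many columns, and the two ideals intersect in the finite sets. Membership in
  these ideals decides every case except that of two finite sets, where maxima are compared.\<close>

lemma grid_map_Un:
  assumes "inj_on (\<lambda>x. (r x, c x)) X" "S \<subseteq> X" "T \<subseteq> X"
  shows "grid_map r c N (S \<union> T) = sup (grid_map r c N S) (grid_map r c N T)"
proof -
  have fin: "finite U \<longleftrightarrow> finite (r ` U) \<and> finite (c ` U)" if "U \<subseteq> X" for U
    using finite_if_finite_coordinates[OF inj_on_subset[OF assms(1) that]] finite_imageI by blast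
  show ?thesis
  proof (cases "finite S \<and> finite T")
    case True
    then have "Max (insert 0 (N ` (S \<union> T))) = max (Max (insert 0 (N ` S))) (Max (insert 0 (N ` T)))"
      using Max_Un[of "insert 0 (N ` S)" "insert 0 (N ` T)"] by (simp add: image_Un)
    with True show ?thesis
      by (simp add: grid_map_def del: Max_insert)
  next
    case False
    then show ?thesis
      unfolding grid_map_def finite_Un image_Un fin[OF assms(2)] fin[OF assms(3)]
      by (cases "finite (r ` S)"; cases "finite (r ` T)"; cases "finite (c ` S)"; cases "finite (c ` T)")
        simp_all
  qed
qed

section \<open>Fields of sets as Boolean lattices\<close>

definition inclusion_order :: "'a set set \<Rightarrow> 'a set gorder" where
  "inclusion_order M = \<lparr>carrier = M, eq = (=), le = (\<subseteq>)\<rparr>"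

lemma inclusion_order_simps [simp]:
  "carrier (inclusion_order M) = M"
  "eq (inclusion_order M) = (=)"
  "le (inclusion_order M) = (\<subseteq>)"
  by (simp_all add: inclusion_order_def)

lemma partial_order_inclusion_order: "partial_order (inclusion_order M)"
  by unfold_locales auto

context algebra
begin

lemma least_Upper_inclusion_order:
  assumes "a \<in> M" "b \<in> M"
  shows "least (inclusion_order M) (a \<union> b) (Upper (inclusion_order M) {a, b})"
  using assms by (auto simp: least_def Upper_def)

lemma greatest_Lower_inclusion_order:
  assumes "a \<in> M" "b \<in> M"
  shows "greatest (inclusion_order M) (a \<inter> b) (Lower (inclusion_order M) {a, b})"
  using assms by (auto simp: greatest_def Lower_def)

lemma bounded_lattice_inclusion_order: "bounded_lattice (inclusion_order M)"
proof -
  interpret partial_order "inclusion_order M"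
    by (rule partial_order_inclusion_order)
  have "greatest (inclusion_order M) \<Omega> (carrier (inclusion_order M))"
    "least (inclusion_order M) {} (carrier (inclusion_order M))"
    using sets_into_space by (auto simp: greatest_def least_def)
  then show ?thesis
    by unfold_locales
      (auto intro: least_Upper_inclusion_order greatest_Lower_inclusion_order)
qed

interpretation incl: bounded_lattice "inclusion_order M"
  by (rule bounded_lattice_inclusion_order)

text \<open>A join is a chosen least upper bound; uniqueness of least elements identifies the choice
  with the union.\<close>

lemma join_inclusion_order:
  assumes "a \<in> M" "b \<in> M"
  shows "a \<squnion>\<^bsub>inclusion_order M\<^esub> b = a \<union> b"
proof (rule incl.joinI[where x = a and y = b])
  fix l
  assume "least (inclusion_order M) l (Upper (inclusion_order M) {a, b})"
  then show "l = a \<union> b"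
    using least_Upper_inclusion_order[OF assms] by (rule incl.least_unique)
qed (use assms in simp_all)

lemma meet_inclusion_order:
  assumes "a \<in> M" "b \<in> M"
  shows "a \<sqinter>\<^bsub>inclusion_order M\<^esub> b = a \<inter> b"
proof (rule incl.meetI[where x = a and y = b])
  fix g
  assume "greatest (inclusion_order M) g (Lower (inclusion_order M) {a, b})"
  then show "g = a \<inter> b"
    using greatest_Lower_inclusion_order[OF assms] by (rule incl.greatest_unique)
qed (use assms in simp_all)

lemma top_inclusion_order: "\<top>\<^bsub>inclusion_order M\<^esub> = \<Omega>"
  using incl.top_closed incl.top_higher[of \<Omega>] sets_into_space by auto

lemma bottom_inclusion_order: "\<bottom>\<^bsub>inclusion_order M\<^esub> = {}"
  using incl.bottom_lower[of "{}"] by auto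

lemma boolean_lattice_inclusion_order: "boolean_lattice (inclusion_order M)"
proof
  fix x y z
  assume "x \<in> carrier (inclusion_order M)" "y \<in> carrier (inclusion_order M)"
    "z \<in> carrier (inclusion_order M)"
  then show "x \<sqinter>\<^bsub>inclusion_order M\<^esub> (y \<squnion>\<^bsub>inclusion_order M\<^esub> z) =
      (x \<sqinter>\<^bsub>inclusion_order M\<^esub> y) \<squnion>\<^bsub>inclusion_order M\<^esub> (x \<sqinter>\<^bsub>inclusion_order M\<^esub> z)"
    by (simp add: join_inclusion_order meet_inclusion_order Int Un Int_Un_distrib)
next
  fix x
  assume "x \<in> carrier (inclusion_order M)"
  then show "\<exists>y\<in>carrier (inclusion_order M). x \<sqinter>\<^bsub>inclusion_order M\<^esub> y = \<bottom>\<^bsub>inclusion_order M\<^esub> \<and>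
      x \<squnion>\<^bsub>inclusion_order M\<^esub> y = \<top>\<^bsub>inclusion_order M\<^esub>"
    using sets_into_space[of x] compl_sets[of x]
    by (intro bexI[of _ "\<Omega> - x"])
      (auto simp: join_inclusion_order meet_inclusion_order top_inclusion_order
        bottom_inclusion_order)
qed

end

section \<open>Consequences of a splitting\<close>

lemma D_le_A0_A1_finite: "d \<le> A0 \<Longrightarrow> d \<le> A1 \<Longrightarrow> \<exists>n. d = Fin n"
  by (cases d) auto

text \<open>On a row, \<open>\<mu>\<^sub>1\<close> is at most \<open>A0\<close> because the grid map
  is, and at most \<open>A1\<close> by monotonicity, so its value is a number. Symmetrically,
  \<open>\<mu>\<^sub>0\<close> is a number on each column.\<close>

lemma grid_map_splitting_bound:
  fixes \<mu>\<^sub>0 \<mu>\<^sub>1 :: "'a set \<Rightarrow> D"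
  assumes "algebra X M"
    and sup: "\<And>S. S \<in> M \<Longrightarrow> grid_map r c N S = sup (\<mu>\<^sub>0 S) (\<mu>\<^sub>1 S)"
    and mono0: "monotone_on M (\<subseteq>) (\<le>) \<mu>\<^sub>0" and mono1: "monotone_on M (\<subseteq>) (\<le>) \<mu>\<^sub>1"
    and tops: "\<mu>\<^sub>0 X \<le> A0" "\<mu>\<^sub>1 X \<le> A1"
    and rows: "\<And>a. a \<in> I \<Longrightarrow> {x \<in> X. r x = a} \<in> M"
    and cols: "\<And>b. b \<in> J \<Longrightarrow> {x \<in> X. c x = b} \<in> M"
    and inj: "inj_on (\<lambda>x. (r x, c x)) X"
  shows "\<exists>f g. \<forall>x\<in>X. r x \<in> I \<longrightarrow> c x \<in> J \<longrightarrow> N x \<le> max (f (r x)) (g (c x))"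
proof -
  interpret algebra X M by fact
  have "\<exists>n. \<mu>\<^sub>1 {x \<in> X. r x = a} = Fin n" if "a \<in> I" for a
  proof -
    have "(r ` {x \<in> X. r x = a}) \<subseteq> {a}"
      by auto
    then have "grid_map r c N {x \<in> X. r x = a} \<le> A0"
      using finite_subset by (auto simp: grid_map_def)
    then have "\<mu>\<^sub>1 {x \<in> X. r x = a} \<le> A0"
      using sup[OF rows[OF that]] by simp
    moreover have "\<mu>\<^sub>1 {x \<in> X. r x = a} \<le> \<mu>\<^sub>1 X"
      using monotone_onD[OF mono1 rows[OF that], of X] by auto
    ultimately show ?thesis
      by (intro D_le_A0_A1_finite order_trans[OF _ tops(2)])
  qed
  then obtain f where f: "\<And>a. a \<in> I \<Longrightarrow> \<mu>\<^sub>1 {x \<in> X. r x = a} = Fin (f a)"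
    by metis
  have "\<exists>n. \<mu>\<^sub>0 {x \<in> X. c x = b} = Fin n" if "b \<in> J" for b
  proof -
    have "(c ` {x \<in> X. c x = b}) \<subseteq> {b}"
      by auto
    then have "finite (c ` {x \<in> X. c x = b})"
      using finite_subset by blast
    \<comment> \<open>\<open>A0\<close> is tested before \<open>A1\<close>, so an infinite column
      must first be shown to meet infinitely many rows.\<close>
    moreover have "inj_on (\<lambda>x. (r x, c x)) {x \<in> X. c x = b}"
      using inj by (rule inj_on_subset) auto
    ultimately have "infinite (r ` {x \<in> X. c x = b})" if "infinite {x \<in> X. c x = b}"
      using finite_if_finite_coordinates that by blast
    with \<open>finite (c ` {x \<in> X. c x = b})\<close> have "grid_map r c N {x \<in> X. c x = b} \<le> A1"
      by (cases "finite {x \<in> X. c x = b}") (simp_all add: grid_map_def)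
    then have "\<mu>\<^sub>0 {x \<in> X. c x = b} \<le> A1"
      using sup[OF cols[OF that]] by simp
    moreover have "\<mu>\<^sub>0 {x \<in> X. c x = b} \<le> \<mu>\<^sub>0 X"
      using monotone_onD[OF mono0 cols[OF that], of X] by auto
    ultimately show ?thesis
      by (intro D_le_A0_A1_finite order_trans[OF _ tops(1)])
  qed
  then obtain g where g: "\<And>b. b \<in> J \<Longrightarrow> \<mu>\<^sub>0 {x \<in> X. c x = b} = Fin (g b)"
    by metis
  have "N x \<le> max (f (r x)) (g (c x))" if x: "x \<in> X" "r x \<in> I" "c x \<in> J" for x
  proof -
    \<comment> \<open>The singleton lies in \<open>M\<close> as the intersection of its row and its
      column; the row then bounds \<open>\<mu>\<^sub>1\<close> and the column bounds
      \<open>\<mu>\<^sub>0\<close>.\<close>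
    have "{y \<in> X. r y = r x} \<inter> {y \<in> X. c y = c x} = {x}"
      using inj x(1) by (auto dest: inj_onD)
    then have "{x} \<in> M"
      using Int[OF rows[OF x(2)] cols[OF x(3)]] by simp
    have "Fin (N x) = sup (\<mu>\<^sub>0 {x}) (\<mu>\<^sub>1 {x})"
      using sup[OF \<open>{x} \<in> M\<close>] by (simp add: grid_map_def)
    also have "\<dots> \<le> sup (Fin (g (c x))) (Fin (f (r x)))"
      using monotone_onD[OF mono0 \<open>{x} \<in> M\<close> cols[OF x(3)]]
        monotone_onD[OF mono1 \<open>{x} \<in> M\<close> rows[OF x(2)]] x
      by (intro sup_mono) (auto simp: f g)
    finally show ?thesis
      by (simp add: max.commute)
  qed
  then have "\<forall>x\<in>X. r x \<in> I \<longrightarrow> c x \<in> J \<longrightarrow> N x \<le> max (f (r x)) (g (c x))"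
    by simp
  then show ?thesis
    by (intro exI)
qed

section \<open>Construction of the algebra and the homomorphism\<close>

theorem theoremB:
  shows "\<exists>(B :: nat set set gorder) (\<mu> :: nat set set \<Rightarrow> D).
    boolean_lattice B \<and> |carrier B| =o cardSuc natLeq \<and> join_zero_hom B \<mu> \<and>
    \<mu> \<top>\<^bsub>B\<^esub> = Infty \<and>
    \<not> (\<exists>\<mu>\<^sub>0 \<mu>\<^sub>1 :: nat set set \<Rightarrow> D.
        (\<forall>x\<in>carrier B. \<mu> x = sup (\<mu>\<^sub>0 x) (\<mu>\<^sub>1 x)) \<and>
        monotone_on (carrier B) (le B) (\<le>) \<mu>\<^sub>0 \<and>
        monotone_on (carrier B) (le B) (\<le>) \<mu>\<^sub>1 \<and>
        \<mu>\<^sub>0 \<top>\<^bsub>B\<^esub> \<le> A0 \<and> \<mu>\<^sub>1 \<top>\<^bsub>B\<^esub> \<le> A1)"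
proof -
  have Suc_Card: "Card_order (cardSuc natLeq)"
    by (simp add: cardSuc_Card_order natLeq_Card_order)
  \<comment> \<open>By Cantor, there are at least aleph one sets of naturals; \<open>X\<close> will
    consist of aleph one of them.\<close>
  have "natLeq <o |UNIV :: nat set set|"
    using ordIso_ordLess_trans[OF ordIso_symmetric[OF card_of_nat] card_of_Pow[of UNIV]]
    by (simp only: Pow_UNIV)
  then have "cardSuc natLeq \<le>o |UNIV :: nat set set|"
    by (simp only: cardSuc_ordLess_ordLeq[OF natLeq_Card_order card_of_Card_order])
  then have "|Field (cardSuc natLeq)| \<le>o |UNIV :: nat set set|"
    by (rule ordIso_ordLeq_trans[OF card_of_Field_ordIso[OF Suc_Card]])
  then obtain X :: "nat set set" where "|Field (cardSuc natLeq)| =o |X|"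
    using internalize_card_of_ordLeq2[THEN iffD1] by blast
  then have X: "|X| =o cardSuc natLeq"
    using card_of_Field_ordIso[OF Suc_Card] by (rule ordIso_transitive[OF ordIso_symmetric])
  have "infinite X"
    using uncountable_if_card_aleph1[OF X] countable_finite by blast
  then have "|X| =o |X \<times> X|"
    by (rule ordIso_symmetric[OF card_of_Times_same_infinite])
  then obtain h where "bij_betw h X (X \<times> X)"
    unfolding card_of_ordIso[symmetric] by blast
  define r where "r = fst \<circ> h"
  define c where "c = snd \<circ> h"
  have h: "bij_betw (\<lambda>x. (r x, c x)) X (X \<times> X)"
    using \<open>bij_betw h X (X \<times> X)\<close> by (simp add: r_def c_def)
  then have inj: "inj_on (\<lambda>x. (r x, c x)) X"
    by (rule bij_betw_imp_inj_on)
  have ex_point: "\<exists>x\<in>X. r x = a \<and> c x = b" if "a \<in> X" "b \<in> X" for a b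
  proof -
    have "(a, b) \<in> (\<lambda>x. (r x, c x)) ` X"
      unfolding bij_betw_imp_surj_on[OF h] using that by simp
    then show ?thesis
      by auto
  qed
  define row where "row a = {x \<in> X. r x = a}" for a
  define col where "col b = {x \<in> X. c x = b}" for b
  define G where "G = row ` X \<union> col ` X"
  \<comment> \<open>Rows with index in \<open>X\<close> are nonempty, so a row determines its index
    and \<open>G\<close> is no smaller than \<open>X\<close>.\<close>
  have "inj_on row X"
    using ex_point by (auto simp: inj_on_def row_def)
  then have "|X| \<le>o |G|"
    by (rule card_of_ordLeqI) (simp add: G_def)
  moreover have "|G| \<le>o |X|"
    unfolding G_def using \<open>infinite X\<close>
    by (intro card_of_Un_ordLeq_infinite_Field card_of_Card_order card_of_image) (simp add: Field_card_of)
  ultimately have G: "|G| =o |X|"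
    by (simp add: ordIso_iff_ordLeq)
  have "infinite G"
    using card_of_ordIso_finite[OF G] \<open>infinite X\<close> by simp
  moreover have "G \<subseteq> Pow X"
    by (auto simp: G_def row_def col_def)
  ultimately obtain M where M: "algebra X M" "G \<subseteq> M" "|M| =o |G|"
    by (rule algebra_generated_card)
  interpret algebra X M by fact
  obtain N :: "nat set \<Rightarrow> nat set \<Rightarrow> nat"
    where N: "\<forall>f g. \<exists>a\<in>X. \<exists>b\<in>X. max (f a) (g b) < N a b"
    using ex_aleph1_matrix_not_max_bounded[OF X] by (rule exE)
  define \<mu> where "\<mu> = grid_map r c (\<lambda>x. N (r x) (c x))"
  have "r x \<in> X" "c x \<in> X" if "x \<in> X" for x
    using bij_betwE[OF h] that by auto
  \<comment> \<open>Both coordinates are onto \<open>X\<close>, so the whole grid meets infinitely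
    many rows and infinitely many columns.\<close>
  then have "r ` X = X" "c ` X = X"
    using ex_point by blast+
  then have top: "\<mu> X = Infty"
    using \<open>infinite X\<close> by (simp add: \<mu>_def grid_map_def)
  have hom: "join_zero_hom (inclusion_order M) \<mu>"
    using grid_map_Un[OF inj] sets_into_space
    by (simp add: join_zero_hom_def join_inclusion_order bottom_inclusion_order \<mu>_def)
      (simp add: grid_map_def bot_D_def)
  have card: "|M| =o cardSuc natLeq"
    by (rule ordIso_transitive[OF M(3) ordIso_transitive[OF G X]])
  have no_split: False
    if sup: "\<forall>S\<in>M. \<mu> S = sup (\<mu>\<^sub>0 S) (\<mu>\<^sub>1 S)"
      and mono: "monotone_on M (\<subseteq>) (\<le>) \<mu>\<^sub>0" "monotone_on M (\<subseteq>) (\<le>) \<mu>\<^sub>1"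
      and tops: "\<mu>\<^sub>0 X \<le> A0" "\<mu>\<^sub>1 X \<le> A1" for \<mu>\<^sub>0 \<mu>\<^sub>1
  proof -
    have "row a \<in> M" "col a \<in> M" if "a \<in> X" for a
      using M(2) that by (auto simp: G_def)
    then have "\<exists>f g. \<forall>x\<in>X. r x \<in> X \<longrightarrow> c x \<in> X \<longrightarrow>
        N (r x) (c x) \<le> max (f (r x)) (g (c x))"
      using sup by (intro grid_map_splitting_bound[OF M(1) _ mono tops _ _ inj])
        (simp_all add: \<mu>_def row_def col_def)
    then obtain f g where fg: "\<forall>x\<in>X. r x \<in> X \<longrightarrow> c x \<in> X \<longrightarrow>
        N (r x) (c x) \<le> max (f (r x)) (g (c x))"
      by (elim exE)
    from N have "\<exists>a\<in>X. \<exists>b\<in>X. max (f a) (g b) < N a b"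
      by (elim allE)
    then obtain a b where ab: "a \<in> X" "b \<in> X" "max (f a) (g b) < N a b"
      by (elim bexE)
    obtain x where x: "x \<in> X" "r x = a" "c x = b"
      using ex_point[OF ab(1,2)] by blast
    with bspec[OF fg x(1)] ab(1,2) have "N a b \<le> max (f a) (g b)"
      by simp
    then show False
      using ab(3) by (rule leD[THEN notE])
  qed
  show ?thesis
  proof (rule exI[of _ "inclusion_order M"], rule exI[of _ \<mu>], intro conjI)
    show "boolean_lattice (inclusion_order M)"
      by (rule boolean_lattice_inclusion_order)
    show "|carrier (inclusion_order M)| =o cardSuc natLeq"
      using card by simp
    show "join_zero_hom (inclusion_order M) \<mu>"
      by (rule hom)
    show "\<mu> \<top>\<^bsub>inclusion_order M\<^esub> = Infty"
      using top by (simp only: top_inclusion_order)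
  qed (unfold top_inclusion_order inclusion_order_simps, intro notI, elim exE conjE, rule no_split)
qed

end
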